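(* Let $v,d,q\ge1$ be integers. For integers $r$ with $0\le r\le\lfloor dq/2\rfloor$ put $$h(r;d)=\lfloor r/d\rfloor^2\left(d+d\lfloor r/d\rfloor-r\right)+\left(r-d\lfloor r/d\rfloor\right)\left(\lfloor r/d\rfloor+1\right)^2,$$ $$g(r;d,q,v)=\frac{v}{r-h(r;d)/q}+\frac{(v-1)^2}{d(q-1)-r(q-1)/q-\frac1v\left(r-h(r;d)/q\right)},$$ and let $R$ be a value of $r\in\{0,1,\dots,\lfloor dq/2\rfloor\}$ that minimizes $g(r;d,q,v)$. Let $\xi^*\in D(v,d,q1_d)$ be a BTIB design such that (i) $\xi^*$ is binary in the test treatments, i.e. $\xi^*(i,k)\in\{0,1\}$ for $1\le i\le v$, $1\le k\le d$; (ii) $\sum_{k=1}^d\xi^*(0,k)=R$; (iii) $\xi^*(0,k)=\lfloor R/d\rfloor$ or $\xi^*(0,k)=\lfloor R/d\rfloor+1$ for every $1\le k\le d$. (These are the $A$-optimal BTIB designs of Majumdar and Notz.) Then $\xi^*$ is also $R$-optimal for comparisons with a control in $D(v,d,q1_d)$.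
   Context: Treatments are labelled $0,1,\dots,v$ ($0$ is the control, the others are test treatments); blocks are labelled $1,\dots,d$. $D(v,d,q1_d)$ is the class of exact block designs with all $d$ blocks of size $q$: functions $\xi:\{0,\dots,v\}\times\{1,\dots,d\}\to\{0,1,2,\dots\}$ with $\sum_{i=0}^v\xi(i,k)=q$ for every $k$; $\xi(i,k)$ is the number of trials with treatment $i$ in block $k$. Put $r_i(\xi)=\sum_k\xi(i,k)$, $\mu_{ij}(\xi)=\sum_{k=1}^d\xi(i,k)\xi(j,k)$, and $Z(\xi)=(\xi(i,k))_{1\le i\le v,\,1\le k\le d}$. A design is BTIB (balanced treatment incomplete block) if $\mu_{01}(\xi)=\cdots=\mu_{0v}(\xi)$ and $\mu_{ij}(\xi)$ takes the same value for all $1\le i\ne j\le v$. The information matrix of $\xi$ for the treatment-control comparisons $\tau_1-\tau_0,\dots,\tau_v-\tau_0$ is the $v\times v$ matrix $$N(\xi)=\mathrm{diag}(r_1,\dots,r_v)-\tfrac1qZZ^T;$$ $\xi$ is feasible if all these comparisons are estimable under $\xi$, equivalently if $N(\xi)$ is nonsingular. A design is $R$-optimal for comparisons with a control in $D(v,d,q1_d)$ if it minimizes $$\Psi_R(N(\xi))=\prod_{i=1}^v(N^{-1}(\xi))_{ii}$$ over $D(v,d,q1_d)$, where $\Psi_R$ is taken to be $+\infty$ for infeasible designs. A design is $A$-optimal if it minimizes the trace of $N^{-1}(\xi)$ over the feasible designs in $D(v,d,q1_d)$. In the formula for $g$, a fraction with positive numerator and zero denominator is read as $+\infty$, and a fraction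 with zero numerator is read as $0$. *)

theory Defs
  imports
    Jordan_Normal_Form.Gauss_Jordan_Elimination
    "HOL-Library.Extended_Real"
begin

text \<open>
  A design is a function \<open>\<xi>\<close>: \<open>\<xi> i k\<close> is the number of trials with treatment \<open>i \<in> {0..v}\<close>
  (\<open>0\<close> is the control) in block \<open>k \<in> {1..d}\<close>. Values of \<open>\<xi>\<close> outside this range are
  irrelevant: nothing below depends on them.
\<close>

type_synonym design = "nat \<Rightarrow> nat \<Rightarrow> nat"

definition designs :: "nat \<Rightarrow> nat \<Rightarrow> nat \<Rightarrow> design set" where
  "designs v d q = {\<xi>. \<forall>k\<in>{1..d}. (\<Sum>i=0..v. \<xi> i k) = q}"

definition replication :: "nat \<Rightarrow> design \<Rightarrow> nat \<Rightarrow> nat" where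
  "replication d \<xi> i = (\<Sum>k=1..d. \<xi> i k)"

definition concurrence :: "nat \<Rightarrow> design \<Rightarrow> nat \<Rightarrow> nat \<Rightarrow> nat" where
  "concurrence d \<xi> i j = (\<Sum>k=1..d. \<xi> i k * \<xi> j k)"

definition BTIB :: "nat \<Rightarrow> nat \<Rightarrow> design \<Rightarrow> bool" where
  "BTIB v d \<xi> \<longleftrightarrow>
     (\<exists>\<mu>. \<forall>i\<in>{1..v}. concurrence d \<xi> 0 i = \<mu>) \<and>
     (\<exists>\<mu>. \<forall>i\<in>{1..v}. \<forall>j\<in>{1..v}. i \<noteq> j \<longrightarrow> concurrence d \<xi> i j = \<mu>)"

text \<open>
  Matrix indices start at \<open>0\<close>, so row \<open>i\<close> stands for test treatment \<open>Suc i\<close> and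
  column \<open>k\<close> for block \<open>Suc k\<close>.
\<close>

definition test_incidence :: "nat \<Rightarrow> nat \<Rightarrow> design \<Rightarrow> real mat" where
  "test_incidence v d \<xi> = mat v d (\<lambda>(i, k). real (\<xi> (Suc i) (Suc k)))"

definition information_matrix :: "nat \<Rightarrow> nat \<Rightarrow> nat \<Rightarrow> design \<Rightarrow> real mat" where
  "information_matrix v d q \<xi> =
     mat_diag v (\<lambda>i. real (replication d \<xi> (Suc i)))
     - (1 / real q) \<cdot>\<^sub>m (test_incidence v d \<xi> * transpose_mat (test_incidence v d \<xi>))"

definition feasible :: "nat \<Rightarrow> nat \<Rightarrow> nat \<Rightarrow> design \<Rightarrow> bool" where
  "feasible v d q \<xi> \<longleftrightarrow> invertible_mat (information_matrix v d q \<xi>)"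

definition psi_R :: "nat \<Rightarrow> nat \<Rightarrow> nat \<Rightarrow> design \<Rightarrow> ereal" where
  "psi_R v d q \<xi> =
     (if feasible v d q \<xi>
      then ereal (\<Prod>i<v. the (mat_inverse (information_matrix v d q \<xi>)) $$ (i, i))
      else \<infinity>)"

definition R_optimal :: "nat \<Rightarrow> nat \<Rightarrow> nat \<Rightarrow> design \<Rightarrow> bool" where
  "R_optimal v d q \<xi> \<longleftrightarrow>
     \<xi> \<in> designs v d q \<and> (\<forall>\<eta>\<in>designs v d q. psi_R v d q \<xi> \<le> psi_R v d q \<eta>)"

definition h :: "nat \<Rightarrow> nat \<Rightarrow> real" where
  "h r d = (let m = real (r div d) in
     m^2 * (real d + real d * m - real r) + (real r - real d * m) * (m + 1)^2)"

text \<open>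
  Division in \<^typ>\<open>ereal\<close> satisfies \<open>a / 0 = \<infinity>\<close> for \<open>a > 0\<close> and \<open>0 / 0 = 0\<close>,
  which is the convention intended for \<open>g\<close>.
\<close>

definition g :: "nat \<Rightarrow> nat \<Rightarrow> nat \<Rightarrow> nat \<Rightarrow> ereal" where
  "g r d q v =
     ereal (real v) / ereal (real r - h r d / real q)
     + ereal ((real v - 1)^2) /
       ereal (real d * (real q - 1) - real r * (real q - 1) / real q
              - 1 / real v * (real r - h r d / real q))"

end

theory Submission
  imports Defs "HOL-Analysis.Convex" "Jordan_Normal_Form.Determinant"
begin

text \<open>
  Write \<open>N\<close> for the information matrix of a feasible design, \<open>x\<close> for the
  sum of all its entries and \<open>t\<close> for its trace. Averaging \<open>N\<close> over all simultaneous permutations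
  of rows and columns gives a completely symmetric matrix with the same \<open>x\<close> and \<open>t\<close>, and every
  diagonal entry of its inverse is \<open>1 / x + (v - 1)\<^sup>2 / (v (t - x / v))\<close>. Since the logarithm of
  each diagonal entry of \<open>N\<^sup>-\<^sup>1\<close> is a convex function of \<open>N\<close>, averaging cannot increase the product of
  these entries. So the product criterion is bounded below by the \<open>v\<close>-th power of the same
  expression that governs the trace criterion, and the Majumdar--Notz analysis of the trace applies.

  The convexity argument is carried out without averaging. The Cauchy--Schwarz inequality for the
  form of \<open>N\<close> gives \<open>u\<^sub>p\<^sup>2 \<le> (N\<^sup>-\<^sup>1)\<^sub>p\<^sub>p (u\<^sup>T N u)\<close> for every vector \<open>u\<close>
  (\<open>inverse_diagonal_Cauchy_Schwarz\<close>). Take for \<open>u\<close> the \<open>p\<close>-th column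
  \<open>\<alpha> e\<^sub>p + \<beta> 1\<close> of the inverse of a completely symmetric matrix with sum \<open>A \<ge> x\<close> and trace
  \<open>T \<ge> t\<close>. As \<open>p\<close> varies, the values \<open>u\<^sup>T N u\<close> add up to an expression in \<open>x\<close> and \<open>t\<close> only, and
  it does not decrease in either when \<open>A \<le> T\<close>, because then \<open>\<beta> \<ge> 0\<close>. The inequality of arithmetic and
  geometric means now yields \<open>prod_inverse_diagonal_ge\<close>.

  If the control is used \<open>r \<le> d q / 2\<close> times, then \<open>x\<close> and \<open>t\<close> are at most the numbers \<open>A\<close> and \<open>T\<close>
  that enter \<open>g(r)\<close>, and \<open>A \<le> T\<close>. If it is used more often, replacing each control count
  by its complement to \<open>q\<close> leaves \<open>x\<close> unchanged and only weakens the bound on \<open>t\<close>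
  (\<open>design_bounds\<close>). Hence every feasible design has criterion value at least \<open>(g(r) / v)\<^sup>v\<close>
  for some admissible \<open>r\<close>, while the given design has a completely symmetric information matrix,
  attains both bounds, and so has the value \<open>(g(R) / v)\<^sup>v\<close> as soon as \<open>g(R)\<close> is finite.
\<close>

section \<open>Diagonal of the inverse of a positive semidefinite matrix\<close>

definition bilinear_form :: "nat \<Rightarrow> (nat \<Rightarrow> nat \<Rightarrow> real) \<Rightarrow> (nat \<Rightarrow> real) \<Rightarrow> (nat \<Rightarrow> real) \<Rightarrow> real" where
  "bilinear_form n F u w = (\<Sum>i<n. \<Sum>j<n. F i j * u i * w j)"

definition positive_semidefinite :: "nat \<Rightarrow> (nat \<Rightarrow> nat \<Rightarrow> real) \<Rightarrow> bool" where
  "positive_semidefinite n F \<longleftrightarrow>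
     (\<forall>i<n. \<forall>j<n. F i j = F j i) \<and> (\<forall>u. 0 \<le> bilinear_form n F u u)"

definition right_inverse :: "nat \<Rightarrow> (nat \<Rightarrow> nat \<Rightarrow> real) \<Rightarrow> (nat \<Rightarrow> nat \<Rightarrow> real) \<Rightarrow> bool" where
  "right_inverse n F G \<longleftrightarrow>
     (\<forall>i<n. \<forall>j<n. (\<Sum>l<n. F i l * G l j) = (if i = j then 1 else 0))"

lemma bilinear_form_add_scale:
  assumes "positive_semidefinite n F"
  shows "bilinear_form n F (\<lambda>i. u i + t * w i) (\<lambda>i. u i + t * w i)
    = bilinear_form n F u u + 2 * t * bilinear_form n F u w + t\<^sup>2 * bilinear_form n F w w"
proof -
  have "bilinear_form n F w u = (\<Sum>j<n. \<Sum>i<n. F i j * w i * u j)"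
    unfolding bilinear_form_def by (rule sum.swap)
  also have "\<dots> = bilinear_form n F u w"
    using assms unfolding bilinear_form_def positive_semidefinite_def
    by (intro sum.cong refl) (auto simp: mult_ac)
  finally have sym: "bilinear_form n F w u = bilinear_form n F u w" .
  have "bilinear_form n F (\<lambda>i. u i + t * w i) (\<lambda>i. u i + t * w i)
    = bilinear_form n F u u + t * bilinear_form n F u w + t * bilinear_form n F w u
      + t\<^sup>2 * bilinear_form n F w w"
    unfolding bilinear_form_def
    by (simp add: sum_distrib_left flip: sum.distrib)
      (intro sum.cong refl, simp add: algebra_simps power2_eq_square)
  with sym show ?thesis by simp
qed

text \<open>
  The column \<open>p\<close> of the inverse represents, through the form of \<open>F\<close>, the functional that reads off
  the coordinate \<open>p\<close>.
\<close>

lemma bilinear_form_inverse_column: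
  assumes "right_inverse n F G" "p < n"
  shows "bilinear_form n F u (\<lambda>i. G i p) = u p"
proof -
  have "bilinear_form n F u (\<lambda>i. G i p) = (\<Sum>i<n. u i * (\<Sum>j<n. F i j * G j p))"
    unfolding bilinear_form_def by (simp add: sum_distrib_left mult_ac)
  also have "\<dots> = (\<Sum>i<n. if i = p then u i else 0)"
    using assms by (intro sum.cong refl) (simp add: right_inverse_def)
  also have "\<dots> = u p"
    using assms(2) by simp
  finally show ?thesis .
qed

lemma inverse_diagonal_nonneg:
  assumes "positive_semidefinite n F" "right_inverse n F G" "p < n"
  shows "0 \<le> G p p"
  using assms(1) bilinear_form_inverse_column[OF assms(2,3), of "\<lambda>i. G i p"]
  by (metis positive_semidefinite_def)

text \<open>
  The form is nonnegative along the line \<open>u + t G e\<^sub>p\<close>. By \<open>bilinear_form_inverse_column\<close> it is there a quadratic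
  polynomial in \<open>t\<close> with coefficients \<open>G p p\<close>, \<open>2 (u p)\<close> and the value at \<open>u\<close>, so its discriminant
  is at most \<open>0\<close>.
\<close>

lemma inverse_diagonal_Cauchy_Schwarz:
  assumes "positive_semidefinite n F" "right_inverse n F G" "p < n"
  shows "(u p)\<^sup>2 \<le> G p p * bilinear_form n F u u"
proof -
  define Q where "Q = bilinear_form n F u u"
  have G: "0 \<le> G p p" by (rule inverse_diagonal_nonneg[OF assms])
  have quad: "0 \<le> Q + 2 * t * u p + t\<^sup>2 * G p p" for t
  proof -
    have "0 \<le> bilinear_form n F (\<lambda>i. u i + t * G i p) (\<lambda>i. u i + t * G i p)"
      using assms(1) by (simp add: positive_semidefinite_def)
    then show ?thesis
      unfolding bilinear_form_add_scale[OF assms(1)] bilinear_form_inverse_column[OF assms(2,3)]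
      by (simp add: Q_def)
  qed
  show ?thesis
  proof (cases "G p p = 0")
    case False
    have "0 \<le> (Q + 2 * (- u p / G p p) * u p + (- u p / G p p)\<^sup>2 * G p p) * G p p"
      by (intro mult_nonneg_nonneg quad G)
    also have "\<dots> = G p p * Q - (u p)\<^sup>2"
      using False by (simp add: field_simps power2_eq_square)
    finally show ?thesis by (simp add: Q_def)
  next
    case True
    have "u p = 0"
    proof (rule ccontr)
      assume "u p \<noteq> 0"
      then have "2 * (- (Q + 1) / (2 * u p)) * u p = - (Q + 1)" by simp
      with quad[of "- (Q + 1) / (2 * u p)"] have "0 \<le> Q + - (Q + 1)"
        by (simp only: True mult_zero_right add_0_right)
      then show False by simp
    qed
    with True show ?thesis by simp
  qed
qed

text \<open>
  A vector at which a positive semidefinite form vanishes is orthogonal, with respect to the form, to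
  every vector; the all-ones vector is not orthogonal to the first column of the inverse.
\<close>

lemma total_pos_of_right_inverse:
  assumes psd: "positive_semidefinite n F" and "right_inverse n F G" "n \<ge> 1"
  shows "0 < bilinear_form n F (\<lambda>_. 1) (\<lambda>_. 1)"
proof -
  have "1 \<le> G 0 0 * bilinear_form n F (\<lambda>_. 1) (\<lambda>_. 1)"
    using inverse_diagonal_Cauchy_Schwarz[OF assms(1,2), of 0 "\<lambda>_. 1"] assms(3) by simp
  moreover have "0 \<le> bilinear_form n F (\<lambda>_. 1) (\<lambda>_. 1)"
    using psd by (simp add: positive_semidefinite_def)
  ultimately show ?thesis by (cases "bilinear_form n F (\<lambda>_. 1) (\<lambda>_. 1) = 0") auto
qed

lemma bilinear_form_unit_plus_const:
  assumes "positive_semidefinite n F" "p < n"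
  shows "bilinear_form n F (\<lambda>i. \<beta> + \<alpha> * (if i = p then 1 else 0)) (\<lambda>i. \<beta> + \<alpha> * (if i = p then 1 else 0))
    = \<beta>\<^sup>2 * bilinear_form n F (\<lambda>_. 1) (\<lambda>_. 1) + 2 * \<alpha> * \<beta> * (\<Sum>i<n. F i p) + \<alpha>\<^sup>2 * F p p"
proof -
  have 1: "bilinear_form n F (\<lambda>_. \<beta>) (\<lambda>_. \<beta>) = \<beta>\<^sup>2 * bilinear_form n F (\<lambda>_. 1) (\<lambda>_. 1)"
    by (simp add: bilinear_form_def power2_eq_square sum_distrib_left mult_ac)
  have 2: "bilinear_form n F (\<lambda>_. \<beta>) (\<lambda>i. if i = p then 1 else 0) = \<beta> * (\<Sum>i<n. F i p)"
    using assms(2) by (simp add: bilinear_form_def sum_distrib_left if_distrib mult_ac cong: if_cong)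
  have 3: "bilinear_form n F (\<lambda>i. if i = p then 1 else 0) (\<lambda>i. if i = p then 1 else 0) = F p p"
  proof -
    have "bilinear_form n F (\<lambda>i. if i = p then 1 else 0) (\<lambda>i. if i = p then 1 else 0)
      = (\<Sum>i<n. if i = p then F i p else 0)"
      unfolding bilinear_form_def
      using assms(2) by (intro sum.cong refl) (simp add: if_distrib cong: if_cong)
    then show ?thesis using assms(2) by simp
  qed
  show ?thesis
    by (simp only: bilinear_form_add_scale[OF assms(1)] 1 2 3 mult.assoc mult.left_commute)
qed

text \<open>
  A completely symmetric matrix of order \<open>n\<close> with entry sum \<open>A\<close> and trace \<open>T\<close> has the simple
  eigenvalue \<open>A / n\<close> on the constant vectors and the eigenvalue \<open>(T - A / n) / (n - 1)\<close> on their
  orthogonal complement. The following three numbers describe its inverse \<open>\<alpha> I + \<beta> J\<close>, where \<open>J\<close> is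
  the all-ones matrix: the diagonal entry \<open>\<alpha> + \<beta>\<close>, then \<open>\<alpha>\<close>, then \<open>\<beta>\<close>. For \<open>n = 1\<close> there is no
  complement and such a matrix requires \<open>T = A\<close>; the formulas then give \<open>\<alpha> = 0\<close> and \<open>\<beta> = 1 / A\<close> whatever
  \<open>T\<close> is, by \<open>x / 0 = 0\<close> if a denominator vanishes.
\<close>

definition balanced_value :: "nat \<Rightarrow> real \<Rightarrow> real \<Rightarrow> real" where
  "balanced_value n A T = 1 / A + (real n - 1)\<^sup>2 / (real n * (T - A / real n))"

definition balanced_identity_coeff :: "nat \<Rightarrow> real \<Rightarrow> real \<Rightarrow> real" where
  "balanced_identity_coeff n A T = (real n - 1) / (T - A / real n)"

definition balanced_ones_coeff :: "nat \<Rightarrow> real \<Rightarrow> real \<Rightarrow> real" where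
  "balanced_ones_coeff n A T = 1 / A - balanced_identity_coeff n A T / real n"

lemma balanced_gap_nonneg:
  assumes "n \<ge> 1" "0 \<le> A" "A \<le> T"
  shows "0 \<le> T - A / real n"
proof -
  have "A / real n \<le> A" using divide_left_mono[of 1 "real n" A] assms by simp
  with assms show ?thesis by linarith
qed

lemma balanced_gap_pos:
  assumes "n \<ge> 2" "0 < A" "A \<le> T"
  shows "0 < T - A / real n"
proof -
  have "A / real n < A" using assms by (simp add: field_simps)
  with assms show ?thesis by linarith
qed

lemma balanced_identity_coeff_mult:
  assumes "n \<ge> 1" "0 < A" "A \<le> T"
  shows "balanced_identity_coeff n A T * (T - A / real n) = real n - 1"
proof (cases "n = 1")
  case False
  then have "n \<ge> 2" using assms(1) by simp
  from balanced_gap_pos[OF this assms(2,3)] show ?thesis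
    by (simp add: balanced_identity_coeff_def)
qed (simp add: balanced_identity_coeff_def)

lemma balanced_identity_coeff_nonneg:
  assumes "n \<ge> 1" "0 < A" "A \<le> T"
  shows "0 \<le> balanced_identity_coeff n A T"
  using balanced_gap_nonneg[of n A T] assms by (simp add: balanced_identity_coeff_def)

text \<open>
  The condition \<open>A \<le> T\<close> says that the eigenvalue on the constant vectors is the smaller one, so the
  inverse has its larger eigenvalue there. This sign makes the estimates below monotone in the
  entry sum.
\<close>

lemma balanced_ones_coeff_nonneg:
  assumes "n \<ge> 1" "0 < A" "A \<le> T"
  shows "0 \<le> balanced_ones_coeff n A T"
proof (cases "n = 1")
  case True
  then show ?thesis using assms by (simp add: balanced_ones_coeff_def balanced_identity_coeff_def)
next
  case False
  then have gap: "0 < T - A / real n" using assms balanced_gap_pos by simp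
  have "(real n - 1) * A \<le> real n * (T - A / real n)"
  proof -
    have "real n * (T - A / real n) = real n * T - A" using assms by (simp add: field_simps)
    moreover have "real n * A \<le> real n * T" using assms by (intro mult_left_mono) auto
    ultimately show ?thesis by (simp add: algebra_simps)
  qed
  then have "balanced_identity_coeff n A T * A \<le> real n"
    using gap by (simp add: balanced_identity_coeff_def pos_divide_le_eq)
  then have "balanced_identity_coeff n A T \<le> real n * (1 / A)"
    using assms(2) by (simp add: pos_le_divide_eq)
  then show ?thesis
    using assms(1) by (simp add: balanced_ones_coeff_def pos_divide_le_eq mult.commute)
qed

lemma balanced_value_split:
  assumes "n \<ge> 1"
  shows "balanced_value n A T = balanced_identity_coeff n A T + balanced_ones_coeff n A T"
proof -
  define \<alpha> where "\<alpha> = balanced_identity_coeff n A T"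
  have "balanced_value n A T = 1 / A + (real n - 1) * \<alpha> / real n"
    by (simp add: balanced_value_def balanced_identity_coeff_def \<alpha>_def power2_eq_square mult_ac)
  also have "(real n - 1) * \<alpha> / real n = \<alpha> - \<alpha> / real n"
    using assms by (simp add: field_simps)
  finally show ?thesis by (simp add: balanced_ones_coeff_def \<alpha>_def)
qed

text \<open>
  For a completely symmetric matrix \<open>N\<close> with entry sum \<open>A\<close> and trace \<open>T\<close>, both sides are the trace
  of \<open>N\<^sup>-\<^sup>1 N N\<^sup>-\<^sup>1 = N\<^sup>-\<^sup>1\<close>. The same polynomial in \<open>\<alpha>\<close> and \<open>\<beta>\<close> arises when the form of an arbitrary
  symmetric matrix is summed over the columns of \<open>\<alpha> I + \<beta> J\<close>.
\<close>

lemma balanced_form_value: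
  assumes "n \<ge> 1" "0 < A" "A \<le> T"
  defines "\<alpha> \<equiv> balanced_identity_coeff n A T" and "\<beta> \<equiv> balanced_ones_coeff n A T"
  shows "\<alpha>\<^sup>2 * T + (2 * \<alpha> * \<beta> + real n * \<beta>\<^sup>2) * A = real n * (\<alpha> + \<beta>)"
proof -
  have n: "real n > 0" using assms by simp
  have b: "\<beta> = 1 / A - \<alpha> / real n" by (simp add: \<beta>_def \<alpha>_def balanced_ones_coeff_def)
  have "\<alpha>\<^sup>2 * T + (2 * \<alpha> * \<beta> + real n * \<beta>\<^sup>2) * A
    = \<alpha> * (\<alpha> * (T - A / real n)) + A / real n * (\<alpha> + real n * \<beta>)\<^sup>2"
    using n by (simp add: field_simps power2_eq_square)
  also have "\<alpha> * (T - A / real n) = real n - 1"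
    unfolding \<alpha>_def by (rule balanced_identity_coeff_mult[OF assms(1-3)])
  also have "\<alpha> + real n * \<beta> = real n / A"
    using n by (simp add: b field_simps)
  also have "\<alpha> * (real n - 1) + A / real n * (real n / A)\<^sup>2 = real n * (\<alpha> + \<beta>)"
    using n assms(2) by (simp add: b field_simps power2_eq_square)
  finally show ?thesis .
qed

lemma balanced_value_pos:
  assumes "n \<ge> 1" "0 < A" "A \<le> T"
  shows "0 < balanced_value n A T"
proof -
  have "0 \<le> (real n - 1)\<^sup>2 / (real n * (T - A / real n))"
    using balanced_gap_nonneg[of n A T] assms by simp
  then show ?thesis using assms(2) by (simp add: balanced_value_def add_pos_nonneg)
qed

lemma prod_le_mean_power:
  fixes x :: "nat \<Rightarrow> real"
  assumes "n \<ge> 1" "\<And>i. i < n \<Longrightarrow> 0 \<le> x i" "(\<Sum>i<n. x i) \<le> real n * m"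
  shows "(\<Prod>i<n. x i) \<le> m ^ n"
proof -
  have root: "y = (y powr (1 / real n)) ^ n" if "0 \<le> y" for y :: real
    using assms(1) that by (cases "y = 0") (auto simp: powr_realpow[symmetric] powr_powr)
  have "(\<Prod>i<n. x i) = ((\<Prod>i<n. x i) powr (1 / real n)) ^ n"
    using assms(2) by (intro root prod_nonneg) auto
  also have "\<dots> \<le> (\<Sum>i<n. x i / real n) ^ n"
    using arith_geom_mean[of "{..<n}" x] assms(1,2)
    by (intro power_mono) (auto simp: lessThan_empty_iff)
  also have "\<dots> \<le> m ^ n"
    using assms by (intro power_mono)
      (auto simp: pos_divide_le_eq mult.commute simp flip: sum_divide_distrib intro!: divide_nonneg_nonneg sum_nonneg)
  finally show ?thesis .
qed

text \<open>
  The left side is the product of the diagonal entries for the inverse of the completely symmetric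
  matrix with entry sum \<open>A\<close> and trace \<open>T\<close>, which is thus extremal. The Cauchy--Schwarz
  bound is applied to the columns of the inverse of that extremal matrix.
  This choice of test vectors has two effects: the coordinate \<open>p\<close> of the \<open>p\<close>-th vector is the same
  for all \<open>p\<close>, and the form values have a mean that depends on \<open>F\<close> only through its sum and trace.
\<close>

lemma prod_inverse_diagonal_ge:
  assumes psd: "positive_semidefinite n F" and inv: "right_inverse n F G"
    and n: "n \<ge> 1" and A: "0 < A" "A \<le> T"
    and total: "bilinear_form n F (\<lambda>_. 1) (\<lambda>_. 1) \<le> A"
    and trace: "(\<Sum>i<n. F i i) \<le> T"
  shows "balanced_value n A T ^ n \<le> (\<Prod>i<n. G i i)"
proof -
  define \<alpha> where "\<alpha> = balanced_identity_coeff n A T"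
  define \<beta> where "\<beta> = balanced_ones_coeff n A T"
  define c where "c = balanced_value n A T"
  define S where "S = bilinear_form n F (\<lambda>_. 1) (\<lambda>_. 1)"
  \<comment> \<open>\<open>Q p\<close> is the value of the form of \<open>F\<close> at the test vector \<open>\<alpha> e\<^sub>p + \<beta> 1\<close>.\<close>
  define Q where "Q p = \<beta>\<^sup>2 * S + 2 * \<alpha> * \<beta> * (\<Sum>i<n. F i p) + \<alpha>\<^sup>2 * F p p" for p
  have c: "c = \<alpha> + \<beta>" "0 < c"
    using balanced_value_split[OF n] balanced_value_pos[OF n A] by (simp_all add: c_def \<alpha>_def \<beta>_def)
  have nonneg: "0 \<le> \<alpha>" "0 \<le> \<beta>"
    using balanced_identity_coeff_nonneg[OF n A] balanced_ones_coeff_nonneg[OF n A]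
    by (simp_all add: \<alpha>_def \<beta>_def)
  note Q_form = bilinear_form_unit_plus_const[OF psd, of _ \<beta> \<alpha>, folded S_def, folded Q_def]
  have Q_nonneg: "0 \<le> Q p" if "p < n" for p
    using psd unfolding Q_form[OF that, symmetric] by (simp add: positive_semidefinite_def)
  have CS: "c\<^sup>2 \<le> G p p * Q p" if "p < n" for p
    using inverse_diagonal_Cauchy_Schwarz[OF psd inv that,
        of "\<lambda>i. \<beta> + \<alpha> * (if i = p then 1 else 0)"]
    unfolding Q_form[OF that] by (simp add: c add.commute)
  have "(\<Sum>p<n. \<Sum>i<n. F i p) = S"
    unfolding S_def bilinear_form_def by (simp add: sum.swap[of F])
  then have "(\<Sum>p<n. Q p) = real n * \<beta>\<^sup>2 * S + 2 * \<alpha> * \<beta> * S + \<alpha>\<^sup>2 * (\<Sum>p<n. F p p)"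
    unfolding Q_def by (simp add: sum.distrib flip: sum_distrib_left)
  also have "\<dots> \<le> real n * \<beta>\<^sup>2 * A + 2 * \<alpha> * \<beta> * A + \<alpha>\<^sup>2 * T"
    using total trace nonneg unfolding S_def
    by (intro add_mono mult_left_mono) auto
  also have "\<dots> = real n * c"
    using balanced_form_value[OF n A] unfolding c \<alpha>_def \<beta>_def by (simp add: algebra_simps)
  finally have mean: "(\<Prod>p<n. Q p) \<le> c ^ n"
    by (intro prod_le_mean_power n Q_nonneg)
  have "c ^ n * c ^ n = (\<Prod>p<n. c\<^sup>2)"
    by (simp add: power2_eq_square power_mult_distrib)
  also have "\<dots> \<le> (\<Prod>p<n. G p p * Q p)"
    using CS by (intro prod_mono) auto
  also have "\<dots> = (\<Prod>p<n. G p p) * (\<Prod>p<n. Q p)" by (rule prod.distrib)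
  also have "\<dots> \<le> (\<Prod>p<n. G p p) * c ^ n"
    using inverse_diagonal_nonneg[OF psd inv] by (intro mult_left_mono mean prod_nonneg) auto
  finally show ?thesis using c(2) by (simp add: c_def)
qed


section \<open>Matrix inverses in terms of entries\<close>

lemma right_inverse_entries:
  assumes "A \<in> carrier_mat n n" "B \<in> carrier_mat n n"
  shows "right_inverse n (\<lambda>i j. A $$ (i, j)) (\<lambda>i j. B $$ (i, j)) \<longleftrightarrow> A * B = 1\<^sub>m n"
proof -
  have entry: "(A * B) $$ (i, j) = (\<Sum>l<n. A $$ (i, l) * B $$ (l, j))" if "i < n" "j < n" for i j
    using assms that by (simp add: scalar_prod_def atLeast0LessThan)
  show ?thesis
  proof
    assume "right_inverse n (\<lambda>i j. A $$ (i, j)) (\<lambda>i j. B $$ (i, j))"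
    then show "A * B = 1\<^sub>m n"
      using assms by (intro eq_matI) (auto simp: entry right_inverse_def simp del: index_mult_mat(1))
  next
    assume "A * B = 1\<^sub>m n"
    then show "right_inverse n (\<lambda>i j. A $$ (i, j)) (\<lambda>i j. B $$ (i, j))"
      using entry by (auto simp: right_inverse_def simp flip: entry)
  qed
qed

lemma invertible_mat_obtain_inverse:
  fixes A :: "'a :: field mat"
  assumes "A \<in> carrier_mat n n" "invertible_mat A"
  obtains B where "B \<in> carrier_mat n n" "A * B = 1\<^sub>m n"
proof -
  obtain B where "A * B = 1\<^sub>m (dim_row A)" "B * A = 1\<^sub>m (dim_row B)"
    using assms(2) by (auto simp: invertible_mat_def inverts_mat_def)
  then have "A * B = 1\<^sub>m n" "B \<in> carrier_mat n n"
    using assms(1) by (metis carrier_matD(1) carrier_matI index_mult_mat(3) index_one_mat(3) carrier_matD(2))+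
  then show ?thesis using that by blast
qed

lemma invertible_mat_and_mat_inverse:
  fixes A :: "'a :: field mat"
  assumes A: "A \<in> carrier_mat n n" and B: "B \<in> carrier_mat n n" and AB: "A * B = 1\<^sub>m n"
  shows "invertible_mat A" "mat_inverse A = Some B"
proof -
  have BA: "B * A = 1\<^sub>m n" by (rule mat_mult_left_right_inverse[OF A B AB])
  show "invertible_mat A"
    unfolding invertible_mat_def inverts_mat_def square_mat.simps
    using A B AB BA by (metis carrier_matD)
  have "A \<in> Units (ring_mat TYPE('a) n n)"
    unfolding Units_def ring_mat_simps using A B AB BA by blast
  then obtain C where C: "mat_inverse A = Some C"
    using mat_inverse(1)[OF A, of n] by blast
  note C' = mat_inverse(2)[OF A C]
  have "C = (B * A) * C" unfolding BA using C' left_mult_one_mat[of C n n] by simp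
  also have "\<dots> = B * (A * C)" using A B C' by (intro assoc_mult_mat) auto
  also have "\<dots> = B" using B C' right_mult_one_mat[of B n n] by simp
  finally show "mat_inverse A = Some B" using C by simp
qed


section \<open>The information matrix of a design\<close>

text \<open>
  The entries of the information matrix as a function, so that they can be manipulated as finite sums;
  the index \<open>i\<close> stands for the test treatment \<open>Suc i\<close>.
\<close>

definition info :: "nat \<Rightarrow> nat \<Rightarrow> design \<Rightarrow> nat \<Rightarrow> nat \<Rightarrow> real" where
  "info d q \<xi> i j = (if i = j then real (replication d \<xi> (Suc i)) else 0)
     - real (concurrence d \<xi> (Suc i) (Suc j)) / real q"

lemma information_matrix_carrier: "information_matrix v d q \<xi> \<in> carrier_mat v v"
  by (rule carrier_matI) (simp_all add: information_matrix_def test_incidence_def)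

lemma information_matrix_entry:
  assumes "i < v" "j < v"
  shows "information_matrix v d q \<xi> $$ (i, j) = info d q \<xi> i j"
  using assms
  by (simp add: information_matrix_def test_incidence_def mat_diag_def info_def scalar_prod_def
      concurrence_def sum.atLeast1_atMost_eq atLeast0LessThan)

lemma right_inverse_information_matrix:
  "right_inverse v (\<lambda>i j. information_matrix v d q \<xi> $$ (i, j)) G
    \<longleftrightarrow> right_inverse v (info d q \<xi>) G"
  by (simp add: right_inverse_def information_matrix_entry)

lemma feasible_obtain_right_inverse:
  assumes "feasible v d q \<xi>"
  obtains G where "right_inverse v (info d q \<xi>) G"
  using assms invertible_mat_obtain_inverse[OF information_matrix_carrier, of v d q \<xi>]
  unfolding feasible_def right_inverse_information_matrix[symmetric]
  by (metis right_inverse_entries information_matrix_carrier)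

lemma psi_R_right_inverse:
  assumes "right_inverse v (info d q \<xi>) G"
  shows "psi_R v d q \<xi> = ereal (\<Prod>i<v. G i i)"
proof -
  define B where "B = mat v v (\<lambda>(i, j). G i j)"
  have B: "B \<in> carrier_mat v v" by (simp add: B_def)
  have "right_inverse v (info d q \<xi>) (\<lambda>i j. B $$ (i, j))"
    using assms by (simp add: right_inverse_def B_def)
  then have "information_matrix v d q \<xi> * B = 1\<^sub>m v"
    by (simp add: right_inverse_entries[OF information_matrix_carrier B, symmetric]
        right_inverse_information_matrix)
  note inv = invertible_mat_and_mat_inverse[OF information_matrix_carrier B this]
  show ?thesis
    by (simp add: psi_R_def feasible_def inv B_def)
qed

lemma design_block_size:
  assumes "\<xi> \<in> designs v d q" "k \<in> {1..d}"
  shows "(\<Sum>i<v. real (\<xi> (Suc i) k)) = real q - real (\<xi> 0 k)" "\<xi> 0 k \<le> q"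
proof -
  have "\<xi> 0 k + (\<Sum>i<v. \<xi> (Suc i) k) = q"
    using assms by (auto simp: designs_def atLeast0AtMost sum.atMost_shift)
  then have "real (\<xi> 0 k) + (\<Sum>i<v. real (\<xi> (Suc i) k)) = real q" and "\<xi> 0 k \<le> q"
    by (simp_all flip: of_nat_add of_nat_sum)
  then show "(\<Sum>i<v. real (\<xi> (Suc i) k)) = real q - real (\<xi> 0 k)" "\<xi> 0 k \<le> q"
    by simp_all
qed

text \<open>
  The form splits over the blocks. For a design, the summand of a block is \<open>q\<close> times the variance of
  \<open>u\<close> over the trials of that block, where \<open>u\<close> is extended by \<open>0\<close> to the control.
\<close>

lemma quadratic_form_info:
  "bilinear_form v (info d q \<xi>) u u =
    (\<Sum>k=1..d. (\<Sum>i<v. real (\<xi> (Suc i) k) * (u i)\<^sup>2) - (\<Sum>i<v. real (\<xi> (Suc i) k) * u i)\<^sup>2 / real q)"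
proof -
  have "bilinear_form v (info d q \<xi>) u u =
    (\<Sum>i<v. \<Sum>j<v. (if i = j then real (replication d \<xi> (Suc i)) * (u i)\<^sup>2 else 0))
    - (\<Sum>i<v. \<Sum>j<v. real (concurrence d \<xi> (Suc i) (Suc j)) * u i * u j) / real q"
    unfolding bilinear_form_def info_def sum_divide_distrib sum_subtractf[symmetric]
    by (intro sum.cong refl) (simp add: algebra_simps power2_eq_square)
  also have "(\<Sum>i<v. \<Sum>j<v. (if i = j then real (replication d \<xi> (Suc i)) * (u i)\<^sup>2 else 0))
    = (\<Sum>i<v. \<Sum>k=1..d. real (\<xi> (Suc i) k) * (u i)\<^sup>2)"
    by (simp add: replication_def sum_distrib_right)
  also have "\<dots> = (\<Sum>k=1..d. \<Sum>i<v. real (\<xi> (Suc i) k) * (u i)\<^sup>2)"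
    by (rule sum.swap)
  also have "(\<Sum>i<v. \<Sum>j<v. real (concurrence d \<xi> (Suc i) (Suc j)) * u i * u j)
    = (\<Sum>i<v. \<Sum>j<v. \<Sum>k=1..d. (real (\<xi> (Suc i) k) * u i) * (real (\<xi> (Suc j) k) * u j))"
    by (simp add: concurrence_def sum_distrib_left sum_distrib_right mult_ac)
  also have "\<dots> = (\<Sum>i<v. \<Sum>k=1..d. \<Sum>j<v. (real (\<xi> (Suc i) k) * u i) * (real (\<xi> (Suc j) k) * u j))"
    by (intro sum.cong refl sum.swap)
  also have "\<dots> = (\<Sum>k=1..d. \<Sum>i<v. \<Sum>j<v. (real (\<xi> (Suc i) k) * u i) * (real (\<xi> (Suc j) k) * u j))"
    by (rule sum.swap)
  also have "\<dots> = (\<Sum>k=1..d. (\<Sum>i<v. real (\<xi> (Suc i) k) * u i)\<^sup>2)"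
    by (simp add: power2_eq_square sum_product)
  finally show ?thesis
    by (simp add: sum_subtractf sum_divide_distrib)
qed

lemma positive_semidefinite_info:
  assumes "\<xi> \<in> designs v d q" "q \<ge> 1"
  shows "positive_semidefinite v (info d q \<xi>)"
proof -
  have "0 \<le> bilinear_form v (info d q \<xi>) u u" for u
    unfolding quadratic_form_info
  proof (intro sum_nonneg)
    fix k assume k: "k \<in> {1..d}"
    define z where "z i = real (\<xi> (Suc i) k)" for i
    have z: "0 \<le> z i" for i by (simp add: z_def)
    have "(\<Sum>i<v. z i * u i)\<^sup>2 = (\<Sum>i<v. sqrt (z i) * (sqrt (z i) * u i))\<^sup>2"
      by (simp add: z flip: mult.assoc)
    also have "\<dots> \<le> (\<Sum>i<v. (sqrt (z i))\<^sup>2) * (\<Sum>i<v. (sqrt (z i) * u i)\<^sup>2)"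
      by (rule Cauchy_Schwarz_ineq_sum)
    also have "\<dots> = (\<Sum>i<v. z i) * (\<Sum>i<v. z i * (u i)\<^sup>2)"
      by (simp add: z power_mult_distrib)
    also have "\<dots> \<le> real q * (\<Sum>i<v. z i * (u i)\<^sup>2)"
      using design_block_size(1)[OF assms(1) k]
      by (intro mult_right_mono sum_nonneg) (auto simp: z_def)
    finally have "(\<Sum>i<v. z i * u i)\<^sup>2 / real q \<le> (\<Sum>i<v. z i * (u i)\<^sup>2)"
      using assms(2) by (simp add: pos_divide_le_eq mult.commute)
    then show "0 \<le> (\<Sum>i<v. real (\<xi> (Suc i) k) * (u i)\<^sup>2) - (\<Sum>i<v. real (\<xi> (Suc i) k) * u i)\<^sup>2 / real q"
      by (simp add: z_def)
  qed
  then show ?thesis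
    by (simp add: positive_semidefinite_def info_def concurrence_def mult.commute)
qed

lemma total_info:
  assumes "\<xi> \<in> designs v d q" "q \<ge> 1"
  shows "bilinear_form v (info d q \<xi>) (\<lambda>_. 1) (\<lambda>_. 1)
    = (\<Sum>k=1..d. real (\<xi> 0 k) * (real q - real (\<xi> 0 k)) / real q)"
proof -
  have "(real q - x) - (real q - x)\<^sup>2 / real q = x * (real q - x) / real q" for x
    using assms(2) by (simp add: field_simps power2_eq_square)
  then show ?thesis
    unfolding quadratic_form_info using design_block_size(1)[OF assms(1)] by simp
qed

lemma trace_info:
  assumes "\<xi> \<in> designs v d q"
  shows "(\<Sum>i<v. info d q \<xi> i i) = (\<Sum>k=1..d. \<Sum>i<v. real (\<xi> (Suc i) k) - (real (\<xi> (Suc i) k))\<^sup>2 / real q)"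
proof -
  have "(\<Sum>i<v. info d q \<xi> i i) = (\<Sum>i<v. \<Sum>k=1..d. real (\<xi> (Suc i) k) - (real (\<xi> (Suc i) k))\<^sup>2 / real q)"
    by (simp add: info_def replication_def concurrence_def sum_subtractf sum_divide_distrib power2_eq_square)
  then show ?thesis by (simp only: sum.swap[of _ "{..<v}"])
qed

lemma design_test_total:
  assumes "\<xi> \<in> designs v d q"
  shows "(\<Sum>k=1..d. \<Sum>i<v. real (\<xi> (Suc i) k)) = real d * real q - real (replication d \<xi> 0)"
  using design_block_size(1)[OF assms] by (simp add: sum_subtractf replication_def)


section \<open>The Majumdar--Notz bounds\<close>

definition total_bound :: "nat \<Rightarrow> nat \<Rightarrow> nat \<Rightarrow> real" where
  "total_bound d q r = real r - h r d / real q"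

definition trace_bound :: "nat \<Rightarrow> nat \<Rightarrow> nat \<Rightarrow> real" where
  "trace_bound d q r = (real d * real q - real r) * (1 - 1 / real q)"

text \<open>
  The chord of the parabola \<open>x\<^sup>2\<close> between the consecutive integers \<open>m\<close> and \<open>m + 1\<close> is
  \<open>(2 m + 1) x - m (m + 1)\<close>. Thus \<open>h r d\<close> is the sum over \<open>d\<close> blocks of the chord values belonging to
  \<open>m = r div d\<close>. It is a lower bound for the sum of squares of integers, which lie above the chord,
  and it is exact for integers in \<open>{m, m + 1}\<close>.
\<close>

lemma h_eq:
  "h r d = (2 * real (r div d) + 1) * real r - real d * real (r div d) * (real (r div d) + 1)"
  by (simp add: h_def Let_def power2_eq_square algebra_simps)

lemma consecutive_product_nonneg:
  fixes x m :: nat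
  shows "0 \<le> (real x - real m) * (real x - real m - 1)"
  by (cases "x \<le> m") (auto intro: mult_nonneg_nonneg mult_nonpos_nonpos)

lemma h_eq_sum_chords:
  fixes x :: "nat \<Rightarrow> nat"
  assumes "(\<Sum>k=1..d. x k) = r"
  shows "h r d = (\<Sum>k=1..d. (2 * real (r div d) + 1) * real (x k)
    - real (r div d) * (real (r div d) + 1))"
proof -
  have "real r = (\<Sum>k=1..d. real (x k))" using assms by auto
  then show ?thesis
    by (simp add: h_eq sum_subtractf sum_distrib_left)
qed

lemma h_le_sum_squares:
  fixes x :: "nat \<Rightarrow> nat"
  assumes "(\<Sum>k=1..d. x k) = r"
  shows "h r d \<le> (\<Sum>k=1..d. (real (x k))\<^sup>2)"
  unfolding h_eq_sum_chords[OF assms]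
  using consecutive_product_nonneg[of _ "r div d"]
  by (intro sum_mono) (simp add: algebra_simps power2_eq_square)

lemma h_eq_sum_squares:
  fixes x :: "nat \<Rightarrow> nat"
  assumes "(\<Sum>k=1..d. x k) = r" "\<forall>k\<in>{1..d}. x k = r div d \<or> x k = r div d + 1"
  shows "h r d = (\<Sum>k=1..d. (real (x k))\<^sup>2)"
  unfolding h_eq_sum_chords[OF assms(1)]
proof (intro sum.cong refl)
  fix k assume "k \<in> {1..d}"
  then have "x k = r div d \<or> x k = r div d + 1" using assms(2) by blast
  then show "(2 * real (r div d) + 1) * real (x k) - real (r div d) * (real (r div d) + 1)
    = (real (x k))\<^sup>2"
    by (elim disjE) (simp_all add: algebra_simps power2_eq_square)
qed

lemma sum_complement_products:
  fixes x :: "nat \<Rightarrow> nat"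
  assumes "q \<ge> 1" "(\<Sum>k=1..d. x k) = r"
  shows "(\<Sum>k=1..d. real (x k) * (real q - real (x k)) / real q)
    = real r - (\<Sum>k=1..d. (real (x k))\<^sup>2) / real q"
proof -
  have "(\<Sum>k=1..d. real (x k) * (real q - real (x k)) / real q)
    = (\<Sum>k=1..d. real (x k) - (real (x k))\<^sup>2 / real q)"
    using assms(1) by (intro sum.cong refl) (simp add: field_simps power2_eq_square)
  then show ?thesis using assms(2) by (auto simp: sum_subtractf sum_divide_distrib)
qed

lemma le_h: "real r \<le> h r d"
proof -
  define m where "m = r div d"
  have "d * m * (m + 1) \<le> d * m * (2 * m)" by (cases m) auto
  also have "\<dots> \<le> 2 * m * r" by (simp add: m_def)
  finally have "real (d * m * (m + 1)) \<le> real (2 * m * r)" by (simp only: of_nat_le_iff)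
  then show ?thesis by (simp add: h_eq m_def algebra_simps)
qed

text \<open>
  With \<open>h r d\<close> at least \<open>r\<close> the total is at most \<open>r (1 - 1 / q)\<close>, while the trace bound is the number
  \<open>d q - r\<close> of test trials times the same factor. This is where \<open>r \<le> d q / 2\<close> enters.
\<close>

lemma total_bound_le_trace_bound:
  assumes "q \<ge> 1" "2 * r \<le> d * q"
  shows "total_bound d q r \<le> trace_bound d q r"
proof -
  have "total_bound d q r \<le> real r * (1 - 1 / real q)"
    using divide_right_mono[OF le_h[of r d], of "real q"] by (simp add: total_bound_def algebra_simps)
  also have "\<dots> \<le> trace_bound d q r"
  proof -
    have "real (2 * r) \<le> real (d * q)" using assms(2) by (simp only: of_nat_le_iff)
    then show ?thesis
      unfolding trace_bound_def using assms(1) by (intro mult_right_mono) auto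
  qed
  finally show ?thesis .
qed

lemma g_eq_balanced_value:
  assumes "v \<ge> 1" "q \<ge> 1" "0 < total_bound d q r" "total_bound d q r \<le> trace_bound d q r"
  shows "g r d q v = ereal (real v * balanced_value v (total_bound d q r) (trace_bound d q r))"
proof -
  define A where "A = total_bound d q r"
  define T where "T = trace_bound d q r"
  have T: "real d * (real q - 1) - real r * (real q - 1) / real q = T"
    using assms(2) by (simp add: T_def trace_bound_def field_simps)
  have g: "g r d q v = ereal (real v) / ereal A + ereal ((real v - 1)\<^sup>2) / ereal (T - A / real v)"
    by (simp add: g_def T flip: total_bound_def A_def)
  have val: "real v * balanced_value v A T = real v / A + (real v - 1)\<^sup>2 / (T - A / real v)"
    using assms(1) by (simp add: balanced_value_def distrib_left)
  have "A > 0" using assms(3) by (simp add: A_def)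
  have second: "ereal ((real v - 1)\<^sup>2) / ereal (T - A / real v) = ereal ((real v - 1)\<^sup>2 / (T - A / real v))"
  proof (cases "v = 1")
    case False
    then have "T - A / real v > 0"
      using balanced_gap_pos[of v A T] assms by (simp add: A_def T_def)
    then show ?thesis by simp
  qed simp
  show ?thesis
    unfolding g second A_def[symmetric] T_def[symmetric] val using \<open>A > 0\<close> by simp
qed

text \<open>
  The second summand of \<open>g\<close> cannot be \<open>-\<infinity>\<close>, because its denominator is nonnegative.
\<close>

lemma g_eq_infinity:
  assumes "v \<ge> 1" "q \<ge> 1" "total_bound d q r = 0" "total_bound d q r \<le> trace_bound d q r"
  shows "g r d q v = \<infinity>"
proof -
  have "real d * (real q - 1) - real r * (real q - 1) / real q = trace_bound d q r"
    using assms(2) by (simp add: trace_bound_def field_simps)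
  then have "g r d q v = ereal (real v) / ereal 0 + ereal ((real v - 1)\<^sup>2) / ereal (trace_bound d q r)"
    using assms(3) by (simp add: g_def flip: total_bound_def)
  moreover have "0 \<le> ereal ((real v - 1)\<^sup>2) / ereal (trace_bound d q r)"
    using assms(3,4) by (cases "trace_bound d q r = 0") (auto simp: divide_ereal_def)
  ultimately show ?thesis
    using assms(1) by (simp add: divide_ereal_def)
qed

text \<open>
  The total depends only on the control counts \<open>\<xi> 0 k\<close>, through \<open>\<xi> 0 k (q - \<xi> 0 k)\<close>, and is therefore
  the same for the complementary counts. So \<open>r\<close> is the number of control trials or its complement to
  \<open>d q\<close>, whichever is smaller. The trace bound uses that an integer is at most its square, and it is
  weakened when \<open>r\<close> is the complement.
\<close>

lemma design_bounds:
  assumes \<xi>: "\<xi> \<in> designs v d q" and q: "q \<ge> 1"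
  obtains r where "2 * r \<le> d * q"
    "bilinear_form v (info d q \<xi>) (\<lambda>_. 1) (\<lambda>_. 1) \<le> total_bound d q r"
    "(\<Sum>i<v. info d q \<xi> i i) \<le> trace_bound d q r"
proof -
  define s where "s = replication d \<xi> 0"
  have s: "(\<Sum>k=1..d. \<xi> 0 k) = s" by (simp add: s_def replication_def)
  have trace: "(\<Sum>i<v. info d q \<xi> i i) \<le> trace_bound d q s"
  proof -
    have "(\<Sum>i<v. info d q \<xi> i i)
      \<le> (\<Sum>k=1..d. \<Sum>i<v. real (\<xi> (Suc i) k) * (1 - 1 / real q))"
      unfolding trace_info[OF \<xi>]
    proof (intro sum_mono)
      fix k i
      have "real (\<xi> (Suc i) k) \<le> (real (\<xi> (Suc i) k))\<^sup>2"
        by (simp add: power2_eq_square flip: of_nat_mult)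
      then have "real (\<xi> (Suc i) k) / real q \<le> (real (\<xi> (Suc i) k))\<^sup>2 / real q"
        by (rule divide_right_mono) simp
      then show "real (\<xi> (Suc i) k) - (real (\<xi> (Suc i) k))\<^sup>2 / real q
        \<le> real (\<xi> (Suc i) k) * (1 - 1 / real q)"
        by (simp add: algebra_simps)
    qed
    also have "\<dots> = trace_bound d q s"
      using design_test_total[OF \<xi>]
      by (simp add: trace_bound_def s_def flip: sum_distrib_right)
    finally show ?thesis .
  qed
  show ?thesis
  proof (cases "2 * s \<le> d * q")
    case True
    have "bilinear_form v (info d q \<xi>) (\<lambda>_. 1) (\<lambda>_. 1) \<le> total_bound d q s"
      unfolding total_info[OF \<xi> q] sum_complement_products[OF q s] total_bound_def
      using h_le_sum_squares[OF s] by (simp add: divide_right_mono)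
    with True trace that show ?thesis by blast
  next
    case False
    define x where "x k = q - \<xi> 0 k" for k
    have x: "real (x k) = real q - real (\<xi> 0 k)" if "k \<in> {1..d}" for k
      using design_block_size(2)[OF \<xi> that] by (simp add: x_def of_nat_diff)
    define r where "r = (\<Sum>k=1..d. x k)"
    have "real r = (\<Sum>k=1..d. real q - real (\<xi> 0 k))"
      using x by (simp add: r_def)
    then have r: "real r = real d * real q - real s"
      using s by (auto simp: sum_subtractf)
    then have "r + s = d * q"
      by (simp flip: of_nat_mult of_nat_add add: eq_diff_eq del: of_nat_mult of_nat_add)
    have "bilinear_form v (info d q \<xi>) (\<lambda>_. 1) (\<lambda>_. 1)
      = (\<Sum>k=1..d. real (x k) * (real q - real (x k)) / real q)"
      unfolding total_info[OF \<xi> q] by (intro sum.cong refl) (simp add: x mult.commute)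
    also have "\<dots> \<le> total_bound d q r"
      unfolding sum_complement_products[OF q r_def[symmetric]] total_bound_def
      using h_le_sum_squares[OF r_def[symmetric]] by (simp add: divide_right_mono)
    finally have "bilinear_form v (info d q \<xi>) (\<lambda>_. 1) (\<lambda>_. 1) \<le> total_bound d q r" .
    moreover have "trace_bound d q s \<le> trace_bound d q r"
      unfolding trace_bound_def using q False \<open>r + s = d * q\<close> by (intro mult_right_mono) auto
    moreover have "2 * r \<le> d * q" using False \<open>r + s = d * q\<close> by linarith
    ultimately show ?thesis using that trace by (meson order_trans)
  qed
qed


section \<open>Balanced designs attain the bounds\<close>

text \<open>
  The two estimates behind the bounds are equalities here: test counts in \<open>{0, 1}\<close> are equal to their
  squares, and control counts in two consecutive integers lie on the chord defining \<open>h\<close>.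
\<close>

lemma evenly_spread_binary_attains_bounds:
  assumes \<xi>: "\<xi> \<in> designs v d q" and q: "q \<ge> 1"
    and bin: "\<forall>i\<in>{1..v}. \<forall>k\<in>{1..d}. \<xi> i k \<in> {0, 1}"
    and R: "(\<Sum>k=1..d. \<xi> 0 k) = R"
    and spread: "\<forall>k\<in>{1..d}. \<xi> 0 k = R div d \<or> \<xi> 0 k = R div d + 1"
  shows "bilinear_form v (info d q \<xi>) (\<lambda>_. 1) (\<lambda>_. 1) = total_bound d q R"
    "(\<Sum>i<v. info d q \<xi> i i) = trace_bound d q R"
proof -
  show "bilinear_form v (info d q \<xi>) (\<lambda>_. 1) (\<lambda>_. 1) = total_bound d q R"
    unfolding total_info[OF \<xi> q] sum_complement_products[OF q R] total_bound_def
    using h_eq_sum_squares[OF R spread] by simp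
  have "(\<Sum>i<v. info d q \<xi> i i) = (\<Sum>k=1..d. \<Sum>i<v. real (\<xi> (Suc i) k) * (1 - 1 / real q))"
    unfolding trace_info[OF \<xi>]
  proof (intro sum.cong refl)
    fix k i assume "k \<in> {1..d}" "i \<in> {..<v}"
    then have "\<xi> (Suc i) k \<in> {0, 1}" using bin by auto
    then show "real (\<xi> (Suc i) k) - (real (\<xi> (Suc i) k))\<^sup>2 / real q
        = real (\<xi> (Suc i) k) * (1 - 1 / real q)"
      by auto
  qed
  also have "\<dots> = trace_bound d q R"
    using design_test_total[OF \<xi>] R
    by (simp add: trace_bound_def replication_def flip: sum_distrib_right of_nat_sum)
  finally show "(\<Sum>i<v. info d q \<xi> i i) = trace_bound d q R" .
qed

text \<open>
  The test counts in block \<open>k\<close> sum to \<open>q - \<xi> 0 k\<close>, which turns the sum of concurrences with the test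
  treatments into \<open>q\<close> times the replication minus the concurrence with the control.
\<close>

lemma info_row_sum:
  assumes \<xi>: "\<xi> \<in> designs v d q" and q: "q \<ge> 1" and i: "i < v"
  shows "(\<Sum>j<v. info d q \<xi> i j) = real (concurrence d \<xi> 0 (Suc i)) / real q"
proof -
  have "(\<Sum>j<v. info d q \<xi> i j)
    = real (replication d \<xi> (Suc i)) - (\<Sum>j<v. \<Sum>k=1..d. real (\<xi> (Suc i) k) * real (\<xi> (Suc j) k)) / real q"
    using i by (simp add: info_def sum_subtractf concurrence_def sum_divide_distrib)
  also have "(\<Sum>j<v. \<Sum>k=1..d. real (\<xi> (Suc i) k) * real (\<xi> (Suc j) k))
    = (\<Sum>k=1..d. real (\<xi> (Suc i) k) * (\<Sum>j<v. real (\<xi> (Suc j) k)))"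
    by (subst sum.swap) (simp add: sum_distrib_left)
  also have "\<dots> = (\<Sum>k=1..d. real (\<xi> (Suc i) k) * (real q - real (\<xi> 0 k)))"
    using design_block_size(1)[OF \<xi>] by simp
  also have "\<dots> = real q * real (replication d \<xi> (Suc i)) - real (concurrence d \<xi> 0 (Suc i))"
    by (simp add: replication_def concurrence_def sum_subtractf sum_distrib_left algebra_simps)
  finally show ?thesis using q by (simp add: field_simps)
qed

text \<open>
  Balance makes the off-diagonal entries equal directly. The diagonal entries are then equal because
  all row sums are, these being proportional to the concurrences with the control.
\<close>

lemma BTIB_completely_symmetric:
  assumes \<xi>: "\<xi> \<in> designs v d q" and q: "q \<ge> 1" and "BTIB v d \<xi>"
  obtains a b where "\<And>i j. i < v \<Longrightarrow> j < v \<Longrightarrow> info d q \<xi> i j = (if i = j then a else b)"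
proof -
  obtain m0 m where m0: "\<forall>i\<in>{1..v}. concurrence d \<xi> 0 i = m0"
    and m: "\<forall>i\<in>{1..v}. \<forall>j\<in>{1..v}. i \<noteq> j \<longrightarrow> concurrence d \<xi> i j = m"
    using assms(3) by (auto simp: BTIB_def)
  define b where "b = - real m / real q"
  define a where "a = real m0 / real q - (real v - 1) * b"
  have off: "info d q \<xi> i j = b" if "i < v" "j < v" "i \<noteq> j" for i j
    using m that by (simp add: info_def b_def)
  have "info d q \<xi> i i = a" if "i < v" for i
  proof -
    have "(\<Sum>j<v. info d q \<xi> i j) = info d q \<xi> i i + (\<Sum>j\<in>{..<v} - {i}. info d q \<xi> i j)"
      using that by (intro sum.remove) auto
    also have "(\<Sum>j\<in>{..<v} - {i}. info d q \<xi> i j) = (\<Sum>j\<in>{..<v} - {i}. b)"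
      using off that by (intro sum.cong) auto
    also have "\<dots> = (real v - 1) * b"
      using that by (simp add: of_nat_diff)
    finally show ?thesis
      using info_row_sum[OF \<xi> q that] m0 that by (simp add: a_def)
  qed
  with off that[of a b] show ?thesis by auto
qed

text \<open>
  Here \<open>F = (a - b) I + b J\<close>, and with \<open>J\<^sup>2 = n J\<close> the claim reduces to \<open>\<alpha> (a - b) = 1\<close> and
  \<open>\<beta> (A / n) + \<alpha> b = 0\<close>. For \<open>n = 1\<close> the number \<open>b\<close> is arbitrary, so that case is separate.
\<close>

lemma right_inverse_completely_symmetric:
  assumes n: "n \<ge> 1" and A: "0 < A" "A \<le> T"
    and F: "\<And>i j. i < n \<Longrightarrow> j < n \<Longrightarrow> F i j = (if i = j then a else b)"
    and total: "bilinear_form n F (\<lambda>_. 1) (\<lambda>_. 1) = A"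
    and trace: "(\<Sum>i<n. F i i) = T"
  shows "right_inverse n F
    (\<lambda>i j. balanced_ones_coeff n A T + (if i = j then balanced_identity_coeff n A T else 0))"
proof -
  define \<alpha> where "\<alpha> = balanced_identity_coeff n A T"
  define \<beta> where "\<beta> = balanced_ones_coeff n A T"
  \<comment> \<open>Stated for general coefficients: with \<open>\<gamma> = 1\<close>, \<open>\<delta> = 0\<close> it gives the row sums of \<open>F\<close>.\<close>
  have row: "(\<Sum>j<n. F i j * (\<gamma> + (if j = p then \<delta> else 0)))
      = \<gamma> * (a + (real n - 1) * b) + \<delta> * (if i = p then a else b)" if "i < n" "p < n" for i p \<gamma> \<delta>
  proof -
    have "(\<Sum>j<n. F i j * (\<gamma> + (if j = p then \<delta> else 0)))
      = (\<Sum>j<n. b * \<gamma> + (if j = i then (a - b) * \<gamma> else 0) + (if j = p then \<delta> * F i p else 0))"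
      using F that by (intro sum.cong refl) (auto simp: algebra_simps)
    also have "\<dots> = \<gamma> * (a + (real n - 1) * b) + \<delta> * F i p"
      using that by (simp add: sum.distrib algebra_simps)
    finally show ?thesis using F that by simp
  qed
  have T: "T = real n * a" using trace F by simp
  have "A = (\<Sum>i<n. a + (real n - 1) * b)"
    using row[of _ 0 1 0] n
    unfolding total[symmetric] bilinear_form_def by (intro sum.cong refl) simp
  then have A': "A / real n = a + (real n - 1) * b" using n by simp
  have gap: "T - A / real n = (real n - 1) * (a - b)"
    unfolding A' T by (simp add: algebra_simps)
  have \<alpha>: "(real n - 1) * (\<alpha> * (a - b)) = (real n - 1) * 1"
    using balanced_identity_coeff_mult[OF n A] unfolding gap \<alpha>_def by (simp add: algebra_simps)
  have \<beta>: "\<beta> * (A / real n) = 1 / real n - \<alpha> * (A / real n) / real n"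
    using A(1) n by (simp add: \<beta>_def \<alpha>_def balanced_ones_coeff_def field_simps)
  have "\<beta> * (A / real n) + \<alpha> * (if i = j then a else b) = (if i = j then 1 else 0)"
    if "i < n" "j < n" for i j
  proof (cases "n = 1")
    case True
    then show ?thesis using that A(1) \<beta> by (simp add: \<alpha>_def balanced_identity_coeff_def)
  next
    case False
    then have ab: "\<alpha> * (a - b) = 1" using \<alpha> by simp
    have "A / real n = real n * b + (a - b)"
      unfolding A' by (simp add: algebra_simps)
    with \<beta> have "\<beta> * (A / real n) = 1 / real n - \<alpha> * (real n * b + (a - b)) / real n"
      by (simp only:)
    also have "\<dots> = - \<alpha> * b"
      using ab n by (simp add: distrib_left field_simps)
    finally show ?thesis using ab by (simp add: algebra_simps)
  qed
  then show ?thesis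
    unfolding right_inverse_def \<alpha>_def[symmetric] \<beta>_def[symmetric]
    using row by (simp add: A')
qed

theorem theorem6:
  fixes v d q R :: nat and \<xi> :: design
  assumes "v \<ge> 1" and "d \<ge> 1" and "q \<ge> 1"
    and "R \<in> {0..d * q div 2}"
    and "\<forall>r\<in>{0..d * q div 2}. g R d q v \<le> g r d q v"
    and "\<xi> \<in> designs v d q"
    and "BTIB v d \<xi>"
    and "\<forall>i\<in>{1..v}. \<forall>k\<in>{1..d}. \<xi> i k \<in> {0, 1}"
    and "(\<Sum>k=1..d. \<xi> 0 k) = R"
    and "\<forall>k\<in>{1..d}. \<xi> 0 k = R div d \<or> \<xi> 0 k = R div d + 1"
  shows "R_optimal v d q \<xi>"
proof -
  note v = assms(1) and q = assms(3)
  define A where "A = total_bound d q"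
  define T where "T = trace_bound d q"
  have AT: "A r \<le> T r" if "2 * r \<le> d * q" for r
    unfolding A_def T_def by (rule total_bound_le_trace_bound[OF q that])
  have R: "2 * R \<le> d * q" using assms(4) by auto
  note \<xi>_sums = evenly_spread_binary_attains_bounds[OF assms(6) q assms(8-10), folded A_def T_def]
  have "psi_R v d q \<xi> \<le> psi_R v d q \<eta>" if \<eta>: "\<eta> \<in> designs v d q" for \<eta>
  proof (cases "feasible v d q \<eta>")
    case False
    then show ?thesis by (simp add: psi_R_def)
  next
    case True
    then obtain G where G: "right_inverse v (info d q \<eta>) G"
      by (rule feasible_obtain_right_inverse)
    note psd = positive_semidefinite_info[OF \<eta> q]
    obtain r where r: "2 * r \<le> d * q"
      and total: "bilinear_form v (info d q \<eta>) (\<lambda>_. 1) (\<lambda>_. 1) \<le> A r"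
      and trace: "(\<Sum>i<v. info d q \<eta> i i) \<le> T r"
      unfolding A_def T_def by (rule design_bounds[OF \<eta> q])
    have "0 < A r" using total_pos_of_right_inverse[OF psd G v] total by linarith
    have g_r: "g r d q v = ereal (real v * balanced_value v (A r) (T r))"
      using g_eq_balanced_value[OF v q] \<open>0 < A r\<close> AT[OF r] unfolding A_def T_def by blast
    have g_le: "g R d q v \<le> g r d q v" using assms(5) r by auto
    \<comment> \<open>A feasible competitor makes the minimum of \<open>g\<close> finite, which forces the given design to be
      feasible as well.\<close>
    have "A R \<noteq> 0"
    proof
      assume "A R = 0"
      then have "g R d q v = \<infinity>"
        using g_eq_infinity[OF v q] AT[OF R] unfolding A_def T_def by blast
      with g_le g_r show False by simp
    qed
    moreover have "0 \<le> A R"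
      using positive_semidefinite_info[OF assms(6) q]
      unfolding \<xi>_sums(1)[symmetric] by (simp add: positive_semidefinite_def)
    ultimately have "0 < A R" by simp
    have g_R: "g R d q v = ereal (real v * balanced_value v (A R) (T R))"
      using g_eq_balanced_value[OF v q] \<open>0 < A R\<close> AT[OF R] unfolding A_def T_def by blast
    have value_le: "balanced_value v (A R) (T R) \<le> balanced_value v (A r) (T r)"
      using g_le v unfolding g_R g_r by simp
    obtain a b where "\<And>i j. i < v \<Longrightarrow> j < v \<Longrightarrow> info d q \<xi> i j = (if i = j then a else b)"
      using BTIB_completely_symmetric[OF assms(6) q assms(7)] by metis
    then have "right_inverse v (info d q \<xi>)
      (\<lambda>i j. balanced_ones_coeff v (A R) (T R) + (if i = j then balanced_identity_coeff v (A R) (T R) else 0))"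
      by (rule right_inverse_completely_symmetric[OF v \<open>0 < A R\<close> AT[OF R] _ \<xi>_sums])
    then have "psi_R v d q \<xi> = ereal (balanced_value v (A R) (T R) ^ v)"
      by (simp add: psi_R_right_inverse balanced_value_split[OF v] add.commute)
    also have "balanced_value v (A R) (T R) ^ v \<le> balanced_value v (A r) (T r) ^ v"
      using balanced_value_pos[OF v \<open>0 < A R\<close> AT[OF R]] by (intro power_mono value_le) simp
    also have "\<dots> \<le> (\<Prod>i<v. G i i)"
      by (rule prod_inverse_diagonal_ge[OF psd G v \<open>0 < A r\<close> AT[OF r] total trace])
    also have "ereal \<dots> = psi_R v d q \<eta>"
      by (rule psi_R_right_inverse[OF G, symmetric])
    finally show ?thesis by simp
  qed
  with assms(6) show ?thesis by (simp add: R_optimal_def)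
qed

end
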